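(* Let $p$ and $q$ be primes and let $a,b$ be integers with $p\nmid a$ and $q\nmid b$. Let $$\mathbb{C}\mathbb{C}(x):={\sum_{nm\leq x}}^{\prime}\cos\Big(\frac{2\pi na}{p}\Big)\cos\Big(\frac{2\pi mb}{q}\Big).$$ Then for each $\epsilon>0$, as $x\to\infty$, $$\mathbb{C}\mathbb{C}(x)=O(x^{1/3+\epsilon}).$$
   Context: The sum ${\sum}^{\prime}_{nm\le x}$ runs over pairs of positive integers $m,n$ with $nm\le x$; the prime means that if $x$ is an integer, the terms with $nm=x$ are multiplied by $\tfrac12$. The implied constant may depend on $\epsilon,a,b,p,q$. *)

theory Defs
  imports "HOL-Analysis.Analysis" "HOL-Library.Landau_Symbols"
begin

text \<open>The primed sum \<open>\<Sum>' f n m\<close> over pairs of positive integers with \<open>n m \<le> x\<close>. The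
  equality in the weight can hold only if \<open>x\<close> is an integer.\<close>

definition hyperbola_sum' :: "(nat \<Rightarrow> nat \<Rightarrow> real) \<Rightarrow> real \<Rightarrow> real" where
  "hyperbola_sum' f x =
     (\<Sum>(n, m) \<in> {(n, m). 1 \<le> n \<and> 1 \<le> m \<and> real (n * m) \<le> x}.
        (if real (n * m) = x then 1/2 else 1) * f n m)"

definition CC :: "nat \<Rightarrow> nat \<Rightarrow> int \<Rightarrow> int \<Rightarrow> real \<Rightarrow> real" where
  "CC p q a b = hyperbola_sum'
     (\<lambda>n m. cos (2 * pi * real n * real_of_int a / real p) *
            cos (2 * pi * real m * real_of_int b / real q))"

text \<open>The index set is finite, so the sum above is never the default value of \<^const>\<open>sum\<close>.\<close>

lemma finite_hyperbola:
  "finite {(n :: nat, m :: nat). 1 \<le> n \<and> 1 \<le> m \<and> real (n * m) \<le> x}"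
proof (rule finite_subset)
  show "{(n :: nat, m :: nat). 1 \<le> n \<and> 1 \<le> m \<and> real (n * m) \<le> x}
          \<subseteq> {..nat \<lfloor>x\<rfloor>} \<times> {..nat \<lfloor>x\<rfloor>}"
  proof clarify
    fix n m :: nat
    assume nm: "1 \<le> n" "1 \<le> m" and le: "real (n * m) \<le> x"
    have le': "n * m \<le> nat \<lfloor>x\<rfloor>"
      using le by (simp only: le_nat_floor)
    have "n \<le> n * m" "m \<le> n * m"
      using nm by simp_all
    with le' show "n \<in> {..nat \<lfloor>x\<rfloor>} \<and> m \<in> {..nat \<lfloor>x\<rfloor>}"
      by (meson atMost_iff order_trans)
  qed
qed simp

end

theory Submission
  imports Defs "HOL-Real_Asymp.Real_Asymp"
begin

text \<open>The argument is the elementary method of Voronoi and Vinogradov. Write \<open>c\<close> and \<open>d\<close> for the two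
  cosines. They are periodic and sum to zero over a period, so their partial sums are bounded and,
  up to a constant, are combinations of the sawtooth \<open>saw t = frac t - 1/2\<close> at shifts of \<open>t = y / P\<close>
  (lemma \<open>partial_sum_eq_saw\<close>). By the hyperbola method the sum over \<open>n m \<le> N\<close> becomes two sums
  over \<open>m \<le> sqrt N\<close>, and after splitting \<open>m\<close> into residue classes each of them is a bounded
  combination of sums \<open>\<Sum>k<K. saw (A / (k + \<sigma>) - \<rho>)\<close> where \<open>A\<close> is of size \<open>N\<close> and \<open>K\<close> is at most
  of size \<open>sqrt A\<close>. Everything rests on bounding such a sum by \<open>A powr (1/3)\<close> times \<open>ln\<close> squared.

  On a dyadic range \<open>k \<in> {K..<2K}\<close> the function \<open>F k = A / (k + \<sigma>) - \<rho>\<close> has second derivative of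
  size \<open>l = A / K^3\<close>; let \<open>T\<close> be of size \<open>l powr (-1/3)\<close>. Around a point \<open>k\<close>, Dirichlet's theorem gives a fraction \<open>a / q\<close> with \<open>q \<le> T\<close> that
  is within \<open>1 / (q T)\<close> of the slope. On the next \<open>q\<close> integers \<open>F\<close> then differs from an arithmetic
  progression with step \<open>a / q\<close> by \<open>O(1/q)\<close>, and over such a block the sawtooth sums to \<open>O(1)\<close>
  (lemma \<open>saw_sum_near_arith_prog\<close>). Hence the sum is at most of the order of the number of blocks.
  Blocks with a small \<open>q\<close> are the costly ones, but they occur only where the slope is close to a
  fraction with a small denominator, and the slope moves monotonically at speed about \<open>l\<close>, so it
  spends little time there (lemma \<open>card_near_int_le\<close>). Adding up over \<open>q \<le> T\<close> gives
  \<open>O(A powr (1/3) * ln K)\<close> for the dyadic range; the ranges with \<open>K \<le> A powr (1/3)\<close> are bounded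
  trivially. The powers of the logarithm are absorbed in \<open>x powr \<epsilon>\<close>.

  The primed sum is the mean of the full sums over \<open>n m \<le> x\<close> and over \<open>n m < x\<close>, and the bound
  applies to both.\<close>

section \<open>The sawtooth on near-arithmetic progressions\<close>

definition saw :: "real \<Rightarrow> real" where
  "saw t = frac t - 1/2"

lemma abs_saw_le: "\<bar>saw t\<bar> \<le> 1"
  unfolding saw_def using frac_ge_0[of t] frac_lt_1[of t] by linarith

lemma sum_lessThan_real: "(\<Sum>j<k. real j) = real k * (real k - 1) / 2"
  by (induction k) (auto simp: field_simps)

text \<open>The residues \<open>(n + j a) mod q\<close> run through \<open>0, \<dots>, q - 1\<close> once each, so the sum of the
  quotients is known exactly, as in Hermite's identity for \<open>\<Sum>j<q. \<lfloor>y + j / q\<rfloor>\<close>.\<close>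

lemma sum_div_arith_prog:
  fixes a n :: int and q :: nat
  assumes "q > 0" "coprime a (int q)"
  shows "(\<Sum>j<q. real_of_int ((n + int j * a) div int q)) = n + (a - 1) * (real q - 1) / 2"
proof -
  define h where "h j = nat ((n + int j * a) mod int q)" for j
  have h: "int (h j) = (n + int j * a) mod int q" for j
    using assms by (simp add: h_def)
  have inj: "inj_on h {..<q}"
  proof (rule inj_onI)
    fix i j assume ij: "i \<in> {..<q}" "j \<in> {..<q}" "h i = h j"
    then have "(n + int i * a) mod int q = (n + int j * a) mod int q"
      using h by metis
    then have "int q dvd (n + int i * a) - (n + int j * a)"
      by (simp only: mod_eq_dvd_iff)
    then have "int q dvd (int i - int j) * a"
      by (simp add: algebra_simps)
    then have "int q dvd int i - int j"
      using assms(2) by (simp add: coprime_dvd_mult_left_iff coprime_commute)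
    then have "int i mod int q = int j mod int q"
      by (simp only: mod_eq_dvd_iff)
    then show "i = j"
      using ij(1,2) by simp
  qed
  have "h ` {..<q} \<subseteq> {..<q}"
  proof
    fix y assume "y \<in> h ` {..<q}"
    then obtain j where "y = h j" by blast
    then have "int y < int q" using h[of j] assms(1) by simp
    then show "y \<in> {..<q}" by simp
  qed
  then have bij: "h ` {..<q} = {..<q}"
    using inj by (simp add: card_image card_subset_eq)
  have "(\<Sum>j<q. real (h j)) = (\<Sum>i\<in>h ` {..<q}. real i)"
    using inj by (simp add: sum.reindex)
  also have "\<dots> = real q * (real q - 1) / 2"
    unfolding bij by (rule sum_lessThan_real)
  finally have sum_mod: "(\<Sum>j<q. real (h j)) = real q * (real q - 1) / 2" .
  have eq: "real q * real_of_int ((n + int j * a) div int q) = n + real j * a - real (h j)" for j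
  proof -
    have "int q * ((n + int j * a) div int q) = n + int j * a - int (h j)"
      using h[of j] by (simp add: minus_mod_eq_mult_div [symmetric])
    then have "real_of_int (int q * ((n + int j * a) div int q)) = real_of_int (n + int j * a - int (h j))"
      by (rule arg_cong)
    then show ?thesis by simp
  qed
  have "real q * (\<Sum>j<q. real_of_int ((n + int j * a) div int q))
      = (\<Sum>j<q. n + real j * a - real (h j))"
    unfolding sum_distrib_left eq ..
  also have "\<dots> = real q * n + a * (real q * (real q - 1) / 2) - real q * (real q - 1) / 2"
    by (simp add: sum.distrib sum_subtractf sum_mod sum_lessThan_real flip: sum_distrib_right)
  also have "\<dots> = real q * (n + (a - 1) * (real q - 1) / 2)"
    by (simp add: field_simps)
  finally show ?thesis using assms(1) by simp
qed

text \<open>Since \<open>\<lfloor>\<cdot>\<rfloor>\<close> is monotone, a perturbation of size at most \<open>B / q\<close> can be replaced by the extreme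
  shifts \<open>\<plusminus> B / q\<close>; for these the sum of the floors is evaluated exactly, and the two values differ
  by at most \<open>2 B + 1\<close>.\<close>

lemma saw_sum_near_arith_prog:
  fixes z :: "nat \<Rightarrow> real" and a :: int and q :: nat
  assumes "q > 0" "coprime a (int q)"
    and near: "\<And>j. j < q \<Longrightarrow> \<bar>z j - (\<beta> + real j * a / q)\<bar> \<le> B / q"
  shows "\<bar>\<Sum>j<q. saw (z j)\<bar> \<le> 2 * B + 1/2"
proof -
  define s where "s = real_of_int (a - 1) * (real q - 1) / 2"
  have q: "real q > 0" using assms(1) by simp
  have fl: "\<lfloor>(y + real j * a) / q\<rfloor> = (\<lfloor>y\<rfloor> + int j * a) div int q" for y j
  proof -
    have "\<lfloor>(y + real j * a) / q\<rfloor> = \<lfloor>y + real j * a\<rfloor> div int q"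
      by (rule floor_divide_real_eq_div[of "int q", simplified])
    also have "\<lfloor>y + real j * a\<rfloor> = \<lfloor>y\<rfloor> + int j * a"
      by (metis floor_add_int of_int_mult of_int_of_nat_eq)
    finally show ?thesis .
  qed
  have up: "z j \<le> (q * \<beta> + B + real j * a) / q" and lo: "(q * \<beta> - B + real j * a) / q \<le> z j"
    if "j < q" for j
    using near[OF that] q by (auto simp: field_simps abs_le_iff)
  \<comment> \<open>Moving every point up by the largest admissible perturbation gives exact arithmetic progressions.\<close>
  have "(\<Sum>j<q. real_of_int \<lfloor>z j\<rfloor>) \<le> (\<Sum>j<q. real_of_int ((\<lfloor>q * \<beta> + B\<rfloor> + int j * a) div int q))"
    by (rule sum_mono, unfold fl[symmetric]) (simp add: floor_mono up)
  also have "\<dots> = \<lfloor>q * \<beta> + B\<rfloor> + s"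
    using sum_div_arith_prog[OF assms(1,2)] by (simp add: s_def)
  finally have F1: "(\<Sum>j<q. real_of_int \<lfloor>z j\<rfloor>) \<le> q * \<beta> + B + s" by linarith
  have "(\<Sum>j<q. real_of_int \<lfloor>z j\<rfloor>) \<ge> (\<Sum>j<q. real_of_int ((\<lfloor>q * \<beta> - B\<rfloor> + int j * a) div int q))"
    by (rule sum_mono, unfold fl[symmetric]) (simp add: floor_mono lo)
  also have "(\<Sum>j<q. real_of_int ((\<lfloor>q * \<beta> - B\<rfloor> + int j * a) div int q)) = \<lfloor>q * \<beta> - B\<rfloor> + s"
    using sum_div_arith_prog[OF assms(1,2)] by (simp add: s_def)
  finally have F2: "(\<Sum>j<q. real_of_int \<lfloor>z j\<rfloor>) \<ge> q * \<beta> - B - 1 + s" by linarith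
  have lin: "(\<Sum>j<q. (q * \<beta> + C + real j * a) / q) = q * \<beta> + C + s + (real q - 1) / 2" for C
  proof -
    have "(\<Sum>j<q. (q * \<beta> + C + real j * a) / q) = (real q * (q * \<beta> + C) + (real q * (real q - 1) / 2) * a) / q"
      by (simp add: sum.distrib sum_lessThan_real flip: sum_divide_distrib sum_distrib_right)
    also have "\<dots> = q * \<beta> + C + s + (real q - 1) / 2"
      using q by (simp add: s_def field_simps)
    finally show ?thesis .
  qed
  have "(\<Sum>j<q. z j) \<le> q * \<beta> + B + s + (real q - 1) / 2"
    unfolding lin[symmetric] by (rule sum_mono) (simp add: up)
  moreover have "(\<Sum>j<q. z j) \<ge> q * \<beta> - B + s + (real q - 1) / 2"
    using lin[of "-B", symmetric] sum_mono[of "{..<q}" "\<lambda>j. (q * \<beta> - B + real j * a) / q" z] lo by simp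
  moreover have "(\<Sum>j<q. saw (z j)) = (\<Sum>j<q. z j) - (\<Sum>j<q. real_of_int \<lfloor>z j\<rfloor>) - q / 2"
    by (simp add: saw_def frac_def sum_subtractf)
  ultimately show ?thesis using F1 F2 unfolding abs_le_iff by (auto simp: field_simps)
qed

section \<open>Sawtooth sums along a curved sequence\<close>

definition near_int :: "real \<Rightarrow> real \<Rightarrow> bool" where
  "near_int \<delta> y \<longleftrightarrow> (\<exists>a::int. \<bar>y - a\<bar> \<le> \<delta>)"

lemma card_le_diameter:
  fixes S :: "nat set"
  assumes "finite S" "D \<ge> 0" "\<And>x y. x \<in> S \<Longrightarrow> y \<in> S \<Longrightarrow> x \<le> y \<Longrightarrow> real y - real x \<le> D"
  shows "real (card S) \<le> D + 1"
proof (cases "S = {}")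
  case False
  have mm: "Min S \<in> S" "Max S \<in> S" "Min S \<le> Max S"
    using assms(1) False by auto
  have "card S \<le> card {Min S..Max S}"
    using assms(1) by (intro card_mono) auto
  then have "real (card S) \<le> real (Max S) - real (Min S) + 1"
    using mm(3) by simp
  then show ?thesis using assms(3)[OF mm] by linarith
qed (use assms(2) in simp)

text \<open>A discrete form of "\<open>F' = g\<close> and \<open>l \<le> F'' \<le> B l\<close>" on \<open>{u..<v}\<close>. The length scale \<open>T\<close> bounds the
  denominators of the approximating fractions; it is chosen so that \<open>l T^3\<close> is bounded, which makes
  the quadratic error \<open>B l q^2\<close> over a block of length \<open>q \<le> T\<close> at most \<open>E / q\<close>.\<close>

locale curved_sequence =
  fixes F g :: "nat \<Rightarrow> real" and l B E :: real and u v T :: nat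
  assumes l: "l > 0" and B: "B > 0" and T: "T > 0"
    and taylor: "\<And>k j. u \<le> k \<Longrightarrow> k + j < v \<Longrightarrow> \<bar>F (k + j) - F k - real j * g k\<bar> \<le> B * l * (real j)\<^sup>2"
    and slope_lower: "\<And>k j. u \<le> k \<Longrightarrow> k + j < v \<Longrightarrow> l * real j \<le> g (k + j) - g k"
    and slope_upper: "\<And>k j. u \<le> k \<Longrightarrow> k + j < v \<Longrightarrow> g (k + j) - g k \<le> B * l * real j"
    and short: "B * l * real T ^ 3 \<le> E"
begin

text \<open>The weight \<open>1 / q\<close> is spread over the places where the slope is close to a fraction with
  denominator \<open>q\<close>. A block of length \<open>q\<close> on which such a fraction is used collects total weight at
  least \<open>1\<close>, so the sum of \<open>resonance\<close> bounds the number of blocks.\<close>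

definition resonance :: "nat \<Rightarrow> real" where
  "resonance n = (\<Sum>q = 1..T. if near_int ((1 + E) / T) (real q * g n) then 1 / real q else 0)"

lemma E_nonneg: "E \<ge> 0"
proof -
  have "0 \<le> B * l * real T ^ 3" using l B by simp
  then show ?thesis using short by linarith
qed

lemma resonance_nonneg: "resonance n \<ge> 0"
  unfolding resonance_def by (intro sum_nonneg) auto

text \<open>One step of the decomposition: the fraction comes from Dirichlet's theorem at \<open>k\<close>. It remains an
  approximation of quality \<open>(1 + E) / T\<close> throughout the block because \<open>q (g (k + j) - g k)\<close> is at
  most \<open>B l T^2 \<le> E / T\<close>.\<close>

lemma resonant_block:
  assumes k: "u \<le> k" "k + T \<le> v"
  obtains q where "1 \<le> q" "q \<le> T"
    "\<bar>\<Sum>n = k..<k + q. saw (F n)\<bar> \<le> 2 * E + 3"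
    "1 \<le> (\<Sum>n = k..<k + q. resonance n)"
proof -
  obtain a q' where aq: "coprime a q'" "0 < q'" "q' \<le> int T" "\<bar>of_int q' * g k - of_int a\<bar> < 1 / T"
    using Dirichlet_approx_coprime[OF T, of "g k"] by blast
  define q where "q = nat q'"
  have q: "1 \<le> q" "q \<le> T" "coprime a (int q)" "\<bar>real q * g k - of_int a\<bar> < 1 / T"
    using aq by (auto simp: q_def)
  have q0: "real q > 0" using q by simp
  have T0: "real T > 0" using T by simp
  have qT: "real q \<le> real T" using q by simp
  have size: "B * l * real T ^ 3 \<ge> B * l * real q ^ 3"
    using qT q0 l B by (intro mult_left_mono power_mono) auto
  have slope: "\<bar>g k - a / q\<bar> \<le> 1 / (T * q)"
  proof -
    have "\<bar>g k - a / q\<bar> = \<bar>real q * g k - a\<bar> / q"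
      using q0 by (simp add: field_simps abs_if)
    also have "\<dots> \<le> (1 / T) / q"
      using q(4) q0 by (intro divide_right_mono) auto
    finally show ?thesis by simp
  qed
  have near: "\<bar>F (k + j) - (F k + real j * a / q)\<bar> \<le> (E + 1) / q" if j: "j < q" for j
  proof -
    have "real j * \<bar>g k - a / q\<bar> \<le> real q * (1 / (T * q))"
      using slope j by (intro mult_mono) auto
    also have "\<dots> = 1 / T" using q0 by simp
    also have "\<dots> \<le> 1 / q" using q0 qT by (simp add: frac_le)
    finally have 1: "\<bar>real j * g k - real j * a / q\<bar> \<le> 1 / q"
      by (simp add: abs_mult flip: right_diff_distrib times_divide_eq_right)
    have "\<bar>F (k + j) - F k - real j * g k\<bar> \<le> B * l * (real j)\<^sup>2"
      using j q k by (intro taylor) auto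
    also have "\<dots> \<le> B * l * (real q)\<^sup>2"
      using j l B by (intro mult_left_mono power_mono) auto
    also have "\<dots> = B * l * real q ^ 3 / q"
      using q0 by (simp add: power2_eq_square power3_eq_cube)
    also have "\<dots> \<le> E / q"
      using size short q0 by (intro divide_right_mono) auto
    finally have "\<bar>F (k + j) - F k - real j * g k\<bar> \<le> E / q" .
    with 1 show ?thesis unfolding add_divide_distrib by linarith
  qed
  have "\<bar>\<Sum>j<q. saw (F (k + j))\<bar> \<le> 2 * (E + 1) + 1 / 2"
    using q near by (intro saw_sum_near_arith_prog[where a = a]) auto
  also have "(\<Sum>j<q. saw (F (k + j))) = (\<Sum>n = k..<k + q. saw (F n))"
    by (subst sum.atLeastLessThan_shift_0) (simp add: lessThan_atLeast0)
  finally have saw: "\<bar>\<Sum>n = k..<k + q. saw (F n)\<bar> \<le> 2 * E + 3" by simp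
  have res: "resonance n \<ge> 1 / q" if n: "n \<in> {k..<k + q}" for n
  proof -
    define j where "j = n - k"
    have j: "n = k + j" "j < q" using n by (auto simp: j_def)
    have "0 \<le> l * real j" using l by simp
    then have g0: "0 \<le> g (k + j) - g k"
      using slope_lower[of k j] j q k by force
    have "real q * (g (k + j) - g k) \<le> real q * (B * l * real j)"
      using slope_upper[of k j] j q k by (intro mult_left_mono) auto
    also have "\<dots> \<le> real T * (B * l * real T)"
      using j qT l B by (intro mult_mono) auto
    also have "\<dots> = B * l * real T ^ 3 / T"
      using T0 by (simp add: power3_eq_cube)
    also have "\<dots> \<le> E / T"
      using short T0 by (intro divide_right_mono) auto
    finally have "\<bar>real q * g n - a\<bar> \<le> 1 / T + E / T"
      using q(4) g0 q0 mult_nonneg_nonneg[of "real q" "g (k + j) - g k"]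
      unfolding j(1) right_diff_distrib by linarith
    then have near: "near_int ((1 + E) / T) (real q * g n)"
      unfolding near_int_def add_divide_distrib by blast
    have "(\<Sum>q\<in>{q}. if near_int ((1 + E) / T) (real q * g n) then 1 / real q else 0) \<le> resonance n"
      unfolding resonance_def using q by (intro sum_mono2) auto
    then show ?thesis using near by simp
  qed
  have "1 = (\<Sum>n = k..<k + q. 1 / real q)"
    using q0 by simp
  also have "\<dots> \<le> (\<Sum>n = k..<k + q. resonance n)"
    using res by (intro sum_mono) auto
  finally show thesis using q saw that by blast
qed

text \<open>The blocks are cut off greedily from the left. The final piece, shorter than \<open>T\<close>, is bounded
  trivially.\<close>

lemma saw_sum_le_resonance:
  assumes "u \<le> k" "k \<le> v"
  shows "\<bar>\<Sum>n = k..<v. saw (F n)\<bar> \<le> (2 * E + 3) * (\<Sum>n = k..<v. resonance n) + T"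
  using assms
proof (induction "v - k" arbitrary: k rule: less_induct)
  case less
  show ?case
  proof (cases "k + T \<le> v")
    case False
    have "\<bar>\<Sum>n = k..<v. saw (F n)\<bar> \<le> (\<Sum>n = k..<v. 1)"
      using abs_saw_le by (intro order_trans[OF sum_abs] sum_mono)
    also have "\<dots> \<le> T" using False by simp
    finally show ?thesis
      using E_nonneg mult_nonneg_nonneg[of "2 * E + 3" "\<Sum>n = k..<v. resonance n"]
        sum_nonneg[of "{k..<v}" resonance, OF resonance_nonneg] by linarith
  next
    case True
    obtain q where q: "1 \<le> q" "q \<le> T"
      "\<bar>\<Sum>n = k..<k + q. saw (F n)\<bar> \<le> 2 * E + 3"
      "1 \<le> (\<Sum>n = k..<k + q. resonance n)"
      using resonant_block[of k] less True by blast
    have split: "(\<Sum>n = k..<v. f n) = (\<Sum>n = k..<k + q. f n) + (\<Sum>n = k + q..<v. f n)" for f :: "nat \<Rightarrow> real"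
      using q True by (intro sum.atLeastLessThan_concat[symmetric]) auto
    have IH: "\<bar>\<Sum>n = k + q..<v. saw (F n)\<bar> \<le> (2 * E + 3) * (\<Sum>n = k + q..<v. resonance n) + T"
      using q less.prems True by (intro less.hyps) auto
    have "(2 * E + 3) * 1 \<le> (2 * E + 3) * (\<Sum>n = k..<k + q. resonance n)"
      using q(4) E_nonneg by (intro mult_left_mono) auto
    then have "\<bar>\<Sum>n = k..<k + q. saw (F n)\<bar> + \<bar>\<Sum>n = k + q..<v. saw (F n)\<bar>
        \<le> (2 * E + 3) * (\<Sum>n = k..<k + q. resonance n) + ((2 * E + 3) * (\<Sum>n = k + q..<v. resonance n) + T)"
      using IH q(3) by (intro add_mono) auto
    then show ?thesis
      unfolding split distrib_left add.assoc by (rule order_trans[OF abs_triangle_ineq])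
  qed
qed

text \<open>The first factor bounds the number of integers \<open>a\<close> that \<open>q g\<close> can approach as it increases by at
  most \<open>q B l (v - u)\<close>. The second one bounds the time spent near a single \<open>a\<close>, because \<open>q g\<close>
  increases by at least \<open>q l\<close> at each step.\<close>

lemma card_near_int_le:
  assumes q: "q > 0" and \<delta>: "\<delta> \<ge> 0" and uv: "u \<le> v"
  shows "real (card {n\<in>{u..<v}. near_int \<delta> (real q * g n)})
    \<le> (real q * (B * l * real (v - u)) + 2 * \<delta> + 1) * (2 * \<delta> / (real q * l) + 1)"
proof (cases "u = v")
  case True
  then show ?thesis using q l B \<delta> by simp
next
  case False
  define w where "w = v - 1"
  have w: "u \<le> w" "w < v" using False uv by (auto simp: w_def)
  define I where "I = {\<lceil>q * g u - \<delta>\<rceil>..\<lfloor>q * g w + \<delta>\<rfloor>}"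
  define near where "near a = {n\<in>{u..<v}. \<bar>real q * g n - real_of_int a\<bar> \<le> \<delta>}" for a
  have mono: "g m \<le> g n" if "u \<le> m" "m \<le> n" "n < v" for m n
  proof -
    have "l * real (n - m) \<le> g n - g m"
      using slope_lower[of m "n - m"] that by simp
    then show ?thesis using l by (smt (verit) of_nat_0_le_iff mult_nonneg_nonneg)
  qed
  have cover: "{n\<in>{u..<v}. near_int \<delta> (real q * g n)} \<subseteq> (\<Union>a\<in>I. near a)"
  proof
    fix n assume n: "n \<in> {n\<in>{u..<v}. near_int \<delta> (real q * g n)}"
    then obtain a :: int where a: "\<bar>real q * g n - real_of_int a\<bar> \<le> \<delta>"
      by (auto simp: near_int_def)
    have "g u \<le> g n" "g n \<le> g w" using n by (auto simp: w_def intro!: mono)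
    then have "real q * g u \<le> real q * g n" "real q * g n \<le> real q * g w"
      by (auto intro: mult_left_mono)
    then have "real q * g u - \<delta> \<le> a" "a \<le> real q * g w + \<delta>"
      using a by linarith+
    then have "a \<in> I" by (simp add: I_def ceiling_le_iff le_floor_iff)
    then show "n \<in> (\<Union>a\<in>I. near a)" using n a by (auto simp: near_def)
  qed
  have ql: "real q * l > 0" using q l by simp
  have card_near: "real (card (near a)) \<le> 2 * \<delta> / (real q * l) + 1" for a
  proof (rule card_le_diameter)
    fix m n assume mn: "m \<in> near a" "n \<in> near a" "m \<le> n"
    have "l * real (n - m) \<le> g n - g m"
      using slope_lower[of m "n - m"] mn by (simp add: near_def)
    then have "real q * (l * real (n - m)) \<le> real q * (g n - g m)"
      by (rule mult_left_mono) simp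
    also have "\<dots> \<le> 2 * \<delta>"
      using mn by (simp add: near_def right_diff_distrib abs_le_iff)
    finally show "real n - real m \<le> 2 * \<delta> / (real q * l)"
      using ql mn(3) by (simp add: pos_le_divide_eq mult_ac of_nat_diff)
  qed (use \<delta> ql in \<open>auto simp: near_def\<close>)
  have "g w - g u \<le> B * l * real (w - u)"
    using slope_upper[of u "w - u"] w by simp
  also have "\<dots> \<le> B * l * real (v - u)"
    using B l w by (intro mult_left_mono) auto
  finally have "real q * (g w - g u) \<le> real q * (B * l * real (v - u))"
    by (rule mult_left_mono) simp
  moreover have "real (card I) \<le> real q * (g w - g u) + 2 * \<delta> + 1"
  proof -
    have "0 \<le> real q * (g w - g u)" using mono[of u w] w by simp
    then show ?thesis using \<delta> unfolding I_def right_diff_distrib by (simp; linarith)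
  qed
  ultimately have card_I: "real (card I) \<le> real q * (B * l * real (v - u)) + 2 * \<delta> + 1"
    by linarith
  have "card {n\<in>{u..<v}. near_int \<delta> (real q * g n)} \<le> card (\<Union>a\<in>I. near a)"
    by (rule card_mono[OF _ cover]) (auto simp: I_def near_def)
  also have "\<dots> \<le> (\<Sum>a\<in>I. card (near a))"
    by (rule card_UN_le) (simp add: I_def)
  finally have "real (card {n\<in>{u..<v}. near_int \<delta> (real q * g n)}) \<le> (\<Sum>a\<in>I. real (card (near a)))"
    by (simp flip: of_nat_sum)
  also have "\<dots> \<le> (\<Sum>a\<in>I. 2 * \<delta> / (real q * l) + 1)"
    by (intro sum_mono card_near)
  also have "\<dots> = real (card I) * (2 * \<delta> / (real q * l) + 1)"
    by simp
  also have "\<dots> \<le> (real q * (B * l * real (v - u)) + 2 * \<delta> + 1) * (2 * \<delta> / (real q * l) + 1)"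
    using card_I ql \<delta> by (intro mult_right_mono) auto
  finally show ?thesis .
qed

text \<open>Summing the counts over \<open>q \<le> T\<close> with weight \<open>1 / q\<close>. With \<open>T\<close> of size \<open>l powr (-1/3)\<close> the main
  terms are \<open>M / T\<close>, \<open>B l M T\<close> and \<open>1 / (T l)\<close>, that is, \<open>M l powr (1/3)\<close>, \<open>M l powr (2/3)\<close> and
  \<open>l powr (-2/3)\<close>.\<close>

lemma resonance_sum_le:
  assumes uv: "u \<le> v"
  defines "D \<equiv> 1 + E" and "M \<equiv> real (v - u)"
  shows "(\<Sum>n = u..<v. resonance n)
    \<le> harm T * (2 * B * D * M / T + 2 * D * (2 * D + 1) / (T * l) + (2 * D + 1)) + B * l * M * T"
proof -
  define W where "W = 2 * B * D * M / T + 2 * D * (2 * D + 1) / (T * l) + (2 * D + 1)"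
  have T0: "real T \<ge> 1" using T by simp
  have D: "D \<ge> 1" using E_nonneg by (simp add: D_def)
  have M: "M \<ge> 0" by (simp add: M_def)
  have bound: "1 / real q * real (card {n\<in>{u..<v}. near_int (D / T) (real q * g n)})
      \<le> 1 / real q * W + B * l * M" if q: "q \<in> {1..T}" for q
  proof -
    have q1: "real q \<ge> 1" using q by simp
    have DT: "0 \<le> D / T" "D / T \<le> D"
      using D T0 by (auto simp: divide_le_eq_1 field_simps mult_le_cancel_left1)
    have "real (card {n\<in>{u..<v}. near_int (D / T) (real q * g n)})
        \<le> (real q * (B * l * M) + 2 * (D / T) + 1) * (2 * (D / T) / (real q * l) + 1)"
      unfolding M_def using q DT uv by (intro card_near_int_le) auto
    also have "\<dots> \<le> (real q * (B * l * M) + 2 * D + 1) * (2 * (D / T) / (real q * l) + 1)"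
      using DT l q1 by (intro mult_right_mono) auto
    also have "\<dots> = real q * (B * l * M) + (2 * B * D * M / T + 2 * D * (2 * D + 1) / (T * l) / q + (2 * D + 1))"
      using q1 T0 l by (simp add: field_simps)
    also have "\<dots> \<le> real q * (B * l * M) + W"
    proof -
      have "2 * D * (2 * D + 1) / (T * l) / q \<le> 2 * D * (2 * D + 1) / (T * l) / 1"
        using q1 D l T0 by (intro divide_left_mono) auto
      then show ?thesis by (simp add: W_def)
    qed
    finally have "1 / real q * real (card {n\<in>{u..<v}. near_int (D / T) (real q * g n)})
        \<le> 1 / real q * (real q * (B * l * M) + W)"
      using q1 by (intro mult_left_mono) auto
    also have "\<dots> = 1 / real q * W + B * l * M"
      using q1 by (simp add: field_simps)
    finally show ?thesis .
  qed
  have "(\<Sum>n = u..<v. resonance n)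
      = (\<Sum>q = 1..T. \<Sum>n = u..<v. if near_int (D / T) (real q * g n) then 1 / real q else 0)"
    unfolding resonance_def D_def by (rule sum.swap)
  also have "\<dots> = (\<Sum>q = 1..T. 1 / real q * real (card {n\<in>{u..<v}. near_int (D / T) (real q * g n)}))"
    by (intro sum.cong refl) (simp flip: sum.inter_filter)
  also have "\<dots> \<le> (\<Sum>q = 1..T. 1 / real q * W + B * l * M)"
    using bound by (rule sum_mono)
  also have "\<dots> = harm T * W + B * l * M * T"
    by (simp add: sum.distrib harm_def inverse_eq_divide sum_distrib_right)
  finally show ?thesis unfolding W_def .
qed

end

section \<open>Sawtooth sums along a hyperbola\<close>

lemma harm_le_ln: "n > 0 \<Longrightarrow> harm n \<le> 1 + ln (real n)"
  using euler_mascheroni_sequence_decreasing[of 1 n] by (simp add: harm_expand)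

text \<open>For \<open>A = X^3\<close> the second derivative is of size \<open>l = X^3 / K^3\<close>, so the choice of \<open>T\<close> above is
  \<open>K / X\<close>. Then \<open>M / T\<close> and \<open>l M T\<close> are \<open>O(X)\<close>, and \<open>1 / (T l)\<close> is of size \<open>K^2 / X^2\<close>, which is \<open>O(X)\<close>
  exactly when \<open>K\<close> does not exceed the order of the square root of \<open>A\<close>. The constants come from the
  choice \<open>B = E = 32\<close>.\<close>

lemma saw_hyperbola_dyadic:
  fixes X \<kappa> \<sigma> \<rho> :: real and K u v :: nat
  assumes X: "X \<ge> 1" "X \<le> K" and \<kappa>: "(real K)\<^sup>2 \<le> \<kappa> * X ^ 3"
    and \<sigma>: "0 < \<sigma>" "\<sigma> \<le> 1" and uv: "K \<le> u" "u \<le> v" "v \<le> 2 * K"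
  shows "\<bar>\<Sum>k = u..<v. saw (X ^ 3 / (k + \<sigma>) - \<rho>)\<bar> \<le> (146529 + 2370194 * \<kappa>) * X * (1 + ln K)"
proof -
  define l where "l = X ^ 3 / (8 * real K ^ 3)"
  define T where "T = nat \<lceil>K / X\<rceil>"
  define g where "g k = - (X ^ 3) / (real k + \<sigma>)\<^sup>2" for k :: nat
  define F where "F k = X ^ 3 / (real k + \<sigma>) - \<rho>" for k :: nat
  have X0: "X > 0" using X by simp
  have K1: "real K \<ge> 1" using X by simp
  have KX: "K / X \<ge> 1" using X by simp
  have T_lower: "K / X \<le> T" unfolding T_def using KX by linarith
  have "T \<le> K / X + 1" unfolding T_def using KX by linarith
  then have T_upper: "T \<le> 2 * (K / X)" using KX by linarith
  have T1: "T \<ge> 1" using T_lower KX by linarith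
  have "K / X \<le> K" using X K1 by (simp add: divide_le_eq mult_le_cancel_left1)
  then have TK: "T \<le> K" unfolding T_def by (simp add: ceiling_le_iff)
  have T0: "real T > 0" using T1 by simp
  have l0: "l > 0" using X0 K1 by (simp add: l_def)
  interpret curved_sequence F g l 32 32 u v T
  proof
    show "l > 0" by fact
    show "(0::real) < 32" by simp
    show "T > 0" using T1 by simp
    have "l * real T ^ 3 \<le> l * (2 * (K / X)) ^ 3"
      using l0 T_upper by (intro mult_left_mono power_mono) auto
    also have "\<dots> = 1" using X0 K1 by (simp add: l_def field_simps)
    finally show "32 * l * real T ^ 3 \<le> 32" by simp
  next
    fix k j assume kj: "u \<le> k" "k + j < v"
    define m where "m = real k + \<sigma>"
    define y where "y = real j"
    have m: "real K \<le> m" "m + y \<le> 2 * K" "y \<ge> 0" "m > 0"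
      using kj uv \<sigma> K1 by (auto simp: m_def y_def)
    have Fg: "F k = X ^ 3 / m - \<rho>" "F (k + j) = X ^ 3 / (m + y) - \<rho>"
      "g k = - (X ^ 3) / m\<^sup>2" "g (k + j) = - (X ^ 3) / (m + y)\<^sup>2"
      by (simp_all add: F_def g_def m_def y_def add_ac)
    have l': "X ^ 3 = l * (8 * real K ^ 3)" using K1 by (simp add: l_def)
    \<comment> \<open>Taylor remainder and slope difference of the hyperbola, in closed form.\<close>
    have "a / n - r - (a / m - r) - (n - m) * (- a / m\<^sup>2) = a * (n - m)\<^sup>2 / (m\<^sup>2 * n)"
      if "n > 0" for a n r :: real
      using m(4) that by (simp add: field_simps power2_eq_square)
    from this[of "m + y" "X ^ 3" \<rho>] have "F (k + j) - F k - y * g k = X ^ 3 * y\<^sup>2 / (m\<^sup>2 * (m + y))"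
      unfolding Fg using m by simp
    moreover have "real K ^ 3 \<le> m\<^sup>2 * (m + y)"
      unfolding power3_eq_cube power2_eq_square using m by (intro mult_mono) auto
    then have "X ^ 3 * y\<^sup>2 / (m\<^sup>2 * (m + y)) \<le> X ^ 3 * y\<^sup>2 / real K ^ 3"
      using X0 K1 m by (intro divide_left_mono mult_pos_pos) auto
    moreover have "X ^ 3 * y\<^sup>2 / real K ^ 3 = 8 * l * y\<^sup>2"
      using K1 by (simp add: l')
    moreover have "X ^ 3 * y\<^sup>2 / (m\<^sup>2 * (m + y)) \<ge> 0" using X0 m by simp
    moreover have "8 * l * y\<^sup>2 \<le> 32 * l * y\<^sup>2" using l0 by (intro mult_right_mono) auto
    ultimately show "\<bar>F (k + j) - F k - real j * g k\<bar> \<le> 32 * l * (real j)\<^sup>2"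
      unfolding y_def[symmetric] by linarith
    have "- a / n\<^sup>2 - (- a / m\<^sup>2) = a * (n - m) * (m + n) / (m\<^sup>2 * n\<^sup>2)" if "n > 0" for a n :: real
      using m(4) that by (simp add: field_simps power2_eq_square)
    from this[of "m + y" "X ^ 3"] have gdiff: "g (k + j) - g k = X ^ 3 * y * (2 * m + y) / (m\<^sup>2 * (m + y)\<^sup>2)"
      unfolding Fg using m by (simp add: add.assoc)
    have den_upper: "m\<^sup>2 * (m + y)\<^sup>2 \<le> (2 * real K)\<^sup>2 * (2 * real K)\<^sup>2"
      using m by (intro mult_mono power_mono zero_le_power2; simp)
    have den_lower: "(real K)\<^sup>2 * (real K)\<^sup>2 \<le> m\<^sup>2 * (m + y)\<^sup>2"
      using m by (intro mult_mono power_mono zero_le_power2; simp)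
    have "l * y = X ^ 3 * y * (2 * K) / ((2 * real K)\<^sup>2 * (2 * real K)\<^sup>2)"
      unfolding l' using K1 by (simp add: field_simps power2_eq_square power3_eq_cube)
    also have "\<dots> \<le> X ^ 3 * y * (2 * m + y) / (m\<^sup>2 * (m + y)\<^sup>2)"
    proof (rule frac_le[OF _ _ _ den_upper])
      show "X ^ 3 * y * (2 * K) \<le> X ^ 3 * y * (2 * m + y)"
        using m X0 by (intro mult_left_mono) auto
    qed (use m X0 in simp_all)
    finally show "l * real j \<le> g (k + j) - g k" unfolding gdiff y_def .
    have "X ^ 3 * y * (2 * m + y) / (m\<^sup>2 * (m + y)\<^sup>2) \<le> X ^ 3 * y * (4 * K) / ((real K)\<^sup>2 * (real K)\<^sup>2)"
    proof (rule frac_le[OF _ _ _ den_lower])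
      show "X ^ 3 * y * (2 * m + y) \<le> X ^ 3 * y * (4 * K)"
        using m X0 by (intro mult_left_mono) auto
    qed (use m X0 K1 in simp_all)
    also have "\<dots> = 32 * l * y"
      unfolding l' using K1 by (simp add: field_simps power2_eq_square power3_eq_cube)
    finally show "g (k + j) - g k \<le> 32 * l * real j" unfolding gdiff y_def .
  qed
  define M where "M = real (v - u)"
  have M: "0 \<le> M" "M \<le> K" using uv by (auto simp: M_def)
  define H where "H = 1 + ln (real K)"
  have H1: "H \<ge> 1" using K1 by (simp add: H_def)
  have "harm T \<le> 1 + ln (real T)" using T1 by (intro harm_le_ln) auto
  also have "\<dots> \<le> H" using TK T1 by (simp add: H_def)
  finally have harmH: "harm T \<le> H" .
  have MT: "M / T \<le> X"
  proof -
    have "K \<le> T * X" using T_lower X0 by (simp add: field_simps)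
    then show ?thesis using M(2) T0 by (simp add: divide_le_eq mult_ac)
  qed
  have K2: "(real K)\<^sup>2 / X\<^sup>2 \<le> \<kappa> * X"
    using \<kappa> X0 by (simp add: divide_le_eq power2_eq_square power3_eq_cube mult_ac)
  have Tl: "1 / (T * l) \<le> 8 * \<kappa> * X"
  proof -
    have "1 / (T * l) \<le> 1 / (K / X * l)"
      using T_lower T1 l0 X0 K1 by (intro divide_left_mono mult_right_mono mult_pos_pos) auto
    also have "\<dots> = 8 * ((real K)\<^sup>2 / X\<^sup>2)"
      using X0 K1 by (simp add: l_def field_simps power2_eq_square power3_eq_cube)
    finally show ?thesis using K2 by simp
  qed
  have lMT: "l * M * T \<le> X / 4"
  proof -
    have "l * M * T \<le> l * K * (2 * (K / X))"
      using M T_upper l0 by (intro mult_mono) auto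
    also have "\<dots> = X * X / (4 * K)"
      using X0 K1 by (simp add: l_def field_simps power2_eq_square power3_eq_cube)
    also have "\<dots> \<le> X * K / (4 * K)"
      using X X0 by (intro divide_right_mono mult_left_mono) auto
    finally show ?thesis using K1 by simp
  qed
  have TX: "T \<le> 2 * \<kappa> * X"
  proof -
    have "K / X * 1 \<le> (K / X) * (K / X)" using KX by (intro mult_left_mono) auto
    also have "\<dots> = (real K)\<^sup>2 / X\<^sup>2" by (simp add: power2_eq_square)
    finally show ?thesis using T_upper K2 by linarith
  qed
  have k0: "\<kappa> \<ge> 0"
    using K2 X0 by (smt (verit) divide_nonneg_nonneg zero_le_power2 zero_le_mult_iff)
  have XH: "X \<le> X * H" using X0 H1 by simp
  have kXH: "\<kappa> * X \<le> \<kappa> * X * H" using mult_left_mono[OF H1, of "\<kappa> * X"] X0 k0 by simp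
  have "(\<Sum>n = u..<v. resonance n)
      \<le> harm T * (2 * 32 * 33 * M / T + 2 * 33 * (2 * 33 + 1) / (T * l) + (2 * 33 + 1)) + 32 * l * M * T"
    using resonance_sum_le uv(2) by (simp add: M_def)
  also have "\<dots> \<le> H * (2112 * X + 35376 * (\<kappa> * X) + 67 * X) + 8 * X"
  proof -
    have "2 * 32 * 33 * M / T = 2112 * (M / T)" "2 * 33 * (2 * 33 + 1) / (T * l) = 4422 * (1 / (T * l))"
      by simp_all
    then have "2 * 32 * 33 * M / T + 2 * 33 * (2 * 33 + 1) / (T * l) + (2 * 33 + 1)
        \<le> 2112 * X + 35376 * (\<kappa> * X) + 67 * X"
      using MT Tl X(1) by linarith
    moreover have "0 \<le> 2 * 32 * 33 * M / T + 2 * 33 * (2 * 33 + 1) / (T * l) + (2 * 33 + 1)"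
      using M T0 l0 by simp
    ultimately have "harm T * (2 * 32 * 33 * M / T + 2 * 33 * (2 * 33 + 1) / (T * l) + (2 * 33 + 1))
        \<le> H * (2112 * X + 35376 * (\<kappa> * X) + 67 * X)"
      using harmH H1 by (intro mult_mono) auto
    then show ?thesis using lMT by linarith
  qed
  finally have R: "(\<Sum>n = u..<v. resonance n) \<le> 2187 * (X * H) + 35376 * (\<kappa> * X * H)"
    using XH by (simp add: algebra_simps)
  have "\<bar>\<Sum>n = u..<v. saw (F n)\<bar> \<le> 67 * (\<Sum>n = u..<v. resonance n) + T"
    using saw_sum_le_resonance[of u] uv(2) by simp
  also have "\<dots> \<le> 67 * (2187 * (X * H) + 35376 * (\<kappa> * X * H)) + 2 * (\<kappa> * X * H)"
  proof (rule add_mono)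
    show "67 * (\<Sum>n = u..<v. resonance n) \<le> 67 * (2187 * (X * H) + 35376 * (\<kappa> * X * H))"
      using R by (rule mult_left_mono) simp
    have "T \<le> 2 * (\<kappa> * X)" using TX by (simp add: mult.assoc)
    also have "\<dots> \<le> 2 * (\<kappa> * X * H)" using kXH by (rule mult_left_mono) simp
    finally show "T \<le> 2 * (\<kappa> * X * H)" .
  qed
  also have "\<dots> = (146529 + 2370194 * \<kappa>) * X * H"
    by (simp add: algebra_simps)
  finally show ?thesis unfolding F_def H_def .
qed

text \<open>The range is halved repeatedly until its length is at most \<open>4 X\<close>, where the trivial bound is
  good enough. One logarithm comes from the number of halvings and one from each dyadic range. The
  parameter \<open>Z\<close> lets sums of different lengths \<open>N\<close> share one bound, including \<open>N = 0\<close>.\<close>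

lemma saw_hyperbola_sum:
  fixes X \<kappa> \<sigma> \<rho> Z :: real and N :: nat
  assumes X: "X \<ge> 1" and \<kappa>: "(real N)\<^sup>2 \<le> \<kappa> * X ^ 3" and \<sigma>: "0 < \<sigma>" "\<sigma> \<le> 1"
    and Z: "real N \<le> Z" "1 \<le> Z"
  shows "\<bar>\<Sum>k<N. saw (X ^ 3 / (k + \<sigma>) - \<rho>)\<bar> \<le> (293062 + 4740388 * \<kappa>) * X * (1 + ln Z)\<^sup>2"
proof -
  define s where "s k = saw (X ^ 3 / (real k + \<sigma>) - \<rho>)" for k :: nat
  define C where "C = (146529 + 2370194 * \<kappa>) * X * (1 + ln Z)"
  define R where "R = nat \<lceil>X\<rceil>"
  have R: "X \<le> R" "R \<le> 2 * X" "R \<ge> 1" unfolding R_def using X by linarith+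
  have \<kappa>0: "\<kappa> \<ge> 0"
  proof -
    have "0 \<le> \<kappa> * X ^ 3" using \<kappa> by (meson order_trans zero_le_power2)
    then show ?thesis using X by (simp add: zero_le_mult_iff)
  qed
  have lnZ: "ln Z \<ge> 0" using Z by simp
  have C0: "C \<ge> 0" using \<kappa>0 X lnZ by (simp add: C_def)
  have trivial: "\<bar>\<Sum>k<n. s k\<bar> \<le> n" for n
  proof -
    have "\<bar>\<Sum>k<n. s k\<bar> \<le> (\<Sum>k<n. 1)"
      unfolding s_def using abs_saw_le by (intro order_trans[OF sum_abs] sum_mono)
    then show ?thesis by simp
  qed
  have dyadic: "\<bar>\<Sum>k<n. s k\<bar> \<le> 4 * X + J * C" if "n \<le> 2 ^ J * R" "n \<le> N" for J n
    using that
  proof (induction J arbitrary: n)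
    case 0
    then have "real n \<le> real R" by simp
    then show ?case using trivial[of n] R X by simp
  next
    case (Suc J)
    show ?case
    proof (cases "n \<le> 2 * R")
      case True
      then have "real n \<le> 2 * real R" by simp
      then have "\<bar>\<Sum>k<n. s k\<bar> \<le> 4 * X" using trivial[of n] R by linarith
      moreover have "0 \<le> real (Suc J) * C" using C0 by simp
      ultimately show ?thesis by linarith
    next
      case False
      \<comment> \<open>Rounding up keeps both \<open>n \<le> 2 K\<close> and \<open>K \<le> 2 ^ J * R\<close>.\<close>
      define K where "K = (n + 1) div 2"
      have K: "n \<le> 2 * K" "K \<le> n" "R \<le> K" "K \<le> 2 ^ J * R"
        using False Suc.prems by (auto simp: K_def)
      have KX: "X \<le> K" using K(3) R by linarith
      have KN: "K \<le> N" using K Suc.prems by simp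
      have "(real K)\<^sup>2 \<le> (real N)\<^sup>2" using KN by (intro power_mono) auto
      then have "(real K)\<^sup>2 \<le> \<kappa> * X ^ 3" using \<kappa> by (rule order_trans)
      then have "\<bar>\<Sum>k = K..<n. s k\<bar> \<le> (146529 + 2370194 * \<kappa>) * X * (1 + ln K)"
        unfolding s_def using X KX \<sigma> K by (intro saw_hyperbola_dyadic) auto
      also have "\<dots> \<le> C"
        unfolding C_def using \<kappa>0 X KX Z KN by (intro mult_left_mono) (auto intro!: ln_mono)
      finally have "\<bar>\<Sum>k = K..<n. s k\<bar> \<le> C" .
      moreover have "\<bar>\<Sum>k<K. s k\<bar> \<le> 4 * X + J * C"
        using K KN by (intro Suc.IH) auto
      moreover have "(\<Sum>k<n. s k) = (\<Sum>k<K. s k) + (\<Sum>k = K..<n. s k)"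
        unfolding lessThan_atLeast0 using K by (intro sum.atLeastLessThan_concat[symmetric]) auto
      moreover have "real (Suc J) * C = J * C + C" by (simp add: algebra_simps)
      ultimately show ?thesis by linarith
    qed
  qed
  define J where "J = nat \<lceil>log 2 Z\<rceil>"
  have log0: "log 2 Z \<ge> 0" using Z by simp
  have "N \<le> 2 powr (log 2 Z)" using Z by simp
  also have "\<dots> \<le> 2 powr J" unfolding J_def using log0 by (intro powr_mono) linarith+
  also have "\<dots> = 2 ^ J" by (simp add: powr_realpow)
  finally have "N \<le> 2 ^ J" using of_nat_le_iff[of N "2 ^ J", where 'a = real] by simp
  also have "\<dots> \<le> 2 ^ J * R" using R by simp
  finally have "\<bar>\<Sum>k<N. s k\<bar> \<le> 4 * X + J * C" by (intro dyadic) auto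
  moreover have "real J \<le> 2 * (1 + ln Z)"
  proof -
    have "log 2 Z * ln 2 = ln Z" by (simp add: log_def)
    moreover have "log 2 Z * ln 2 \<ge> log 2 Z * (1/2)"
      using log0 ln2_ge_two_thirds by (intro mult_left_mono) auto
    ultimately have "log 2 Z \<le> 2 * ln Z" by linarith
    moreover have "real J \<le> log 2 Z + 1" unfolding J_def using log0 by linarith
    ultimately show ?thesis by argo
  qed
  then have "J * C \<le> 2 * (1 + ln Z) * C" using C0 by (rule mult_right_mono)
  moreover have "X * 1 \<le> X * (1 + ln Z)\<^sup>2" using X lnZ by (intro mult_left_mono one_le_power) auto
  ultimately have "\<bar>\<Sum>k<N. s k\<bar> \<le> 4 * (X * (1 + ln Z)\<^sup>2) + 2 * (1 + ln Z) * C" by argo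
  also have "\<dots> = (293062 + 4740388 * \<kappa>) * X * (1 + ln Z)\<^sup>2"
    by (simp add: C_def power2_eq_square algebra_simps)
  finally show ?thesis unfolding s_def .
qed

section \<open>Periodic functions of mean zero\<close>

definition periodic_mean_zero :: "nat \<Rightarrow> (nat \<Rightarrow> real) \<Rightarrow> bool" where
  "periodic_mean_zero P c \<longleftrightarrow> P > 0 \<and> (\<forall>n. c (n + P) = c n) \<and> (\<Sum>r = 1..P. c r) = 0"

definition period_norm :: "nat \<Rightarrow> (nat \<Rightarrow> real) \<Rightarrow> real" where
  "period_norm P c = (\<Sum>r = 1..P. \<bar>c r\<bar>)"

lemma period_norm_nonneg: "period_norm P c \<ge> 0"
  by (simp add: period_norm_def sum_nonneg)

text \<open>The class of \<open>s \<in> {1..Q}\<close> contains exactly \<open>(N + Q - s) div Q\<close> members of \<open>{1..N}\<close>.\<close>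

lemma sum_by_residues:
  fixes c G :: "nat \<Rightarrow> real"
  assumes Q: "Q > 0" and per: "\<And>n. c (n + Q) = c n"
  shows "(\<Sum>n = 1..N. c n * G n) = (\<Sum>s = 1..Q. c s * (\<Sum>k < (N + Q - s) div Q. G (s + Q * k)))"
proof -
  have per': "c (s + Q * k) = c s" for s k
  proof (induction k)
    case (Suc k)
    then show ?case using per[of "s + Q * k"] by (simp add: add_ac)
  qed simp
  have less_iff: "k < (N + Q - s) div Q \<longleftrightarrow> s + Q * k \<le> N" if "s \<in> {1..Q}" for s k
  proof -
    have "k < (N + Q - s) div Q \<longleftrightarrow> Suc k * Q \<le> N + Q - s"
      using Q by (simp only: Suc_le_eq[symmetric] less_eq_div_iff_mult_less_eq)
    then show ?thesis using that by (auto simp: mult.commute)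
  qed
  have "(\<Sum>n = 1..N. c n * G n)
      = (\<Sum>(s, k) \<in> Sigma {1..Q} (\<lambda>s. {..<(N + Q - s) div Q}). c s * G (s + Q * k))"
  proof (rule sum.reindex_bij_witness[where j = "\<lambda>n. (Suc ((n - 1) mod Q), (n - 1) div Q)"
        and i = "\<lambda>(s, k). s + Q * k"], goal_cases)
    case (1 n)
    then show ?case using mod_mult_div_eq[of "n - 1" Q] by auto
  next
    case (2 n)
    have s: "Suc ((n - 1) mod Q) \<in> {1..Q}" using Q by (simp add: Suc_le_eq)
    moreover have "Suc ((n - 1) mod Q) + Q * ((n - 1) div Q) \<le> N"
      using 2 mod_mult_div_eq[of "n - 1" Q] by auto
    ultimately show ?case using less_iff by auto
  next
    case (3 x)
    then obtain s k where x: "x = (s, k)" "s \<in> {1..Q}" by auto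
    then obtain t where t: "s = Suc t" "t < Q" by (cases s) auto
    then show ?case using x by simp
  next
    case (4 x)
    then show ?case using less_iff by auto
  next
    case (5 n)
    have "Suc ((n - 1) mod Q) + Q * ((n - 1) div Q) = n"
      using 5 mod_mult_div_eq[of "n - 1" Q] by auto
    then show ?case using per'[of "Suc ((n - 1) mod Q)" "(n - 1) div Q"] by simp
  qed
  also have "\<dots> = (\<Sum>s = 1..Q. c s * (\<Sum>k < (N + Q - s) div Q. G (s + Q * k)))"
    by (simp add: sum_distrib_left sum.Sigma)
  finally show ?thesis .
qed

text \<open>The class of \<open>r\<close> has \<open>\<lfloor>(y - r) / P\<rfloor> + 1\<close> members up to \<open>y\<close>. In this expression the linear term
  \<open>y / P\<close> and the constants are the same for all classes, so they cancel because \<open>c\<close> has mean zero.\<close>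

lemma partial_sum_eq_saw:
  assumes c: "periodic_mean_zero P c" and y: "y \<ge> 0"
  shows "(\<Sum>n = 1..nat \<lfloor>y\<rfloor>. c n)
    = - (\<Sum>r = 1..P. c r * (r / P)) - (\<Sum>r = 1..P. c r * saw (y / P - r / P))"
proof -
  have P: "P > 0" and per: "\<And>n. c (n + P) = c n" and zero: "(\<Sum>r = 1..P. c r) = 0"
    using c by (auto simp: periodic_mean_zero_def)
  define M where "M = nat \<lfloor>y\<rfloor>"
  have M: "int M = \<lfloor>y\<rfloor>" using y by (simp add: M_def)
  have count: "real ((M + P - r) div P) = y / P - r / P + 1/2 - saw (y / P - r / P)" if "r \<in> {1..P}" for r
  proof -
    have "\<lfloor>(y + of_int (int P - int r)) / real P\<rfloor> = \<lfloor>y + of_int (int P - int r)\<rfloor> div int P"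
      by (rule floor_divide_real_eq_div[of "int P", simplified])
    also have "\<dots> = int (M + P - r) div int P"
      using that by (subst floor_add_int[symmetric]) (simp add: M[symmetric] of_nat_diff add_diff_eq)
    finally have "\<lfloor>(y + of_int (int P - int r)) / real P\<rfloor> = int ((M + P - r) div P)"
      by (simp add: zdiv_int)
    moreover have "(y + of_int (int P - int r)) / real P = (y / P - r / P) + 1"
      using P by (simp add: field_simps)
    ultimately have "\<lfloor>y / P - r / P\<rfloor> + 1 = int ((M + P - r) div P)" by simp
    then have "real_of_int (\<lfloor>y / P - r / P\<rfloor> + 1) = real ((M + P - r) div P)" by simp
    then show ?thesis by (simp add: saw_def frac_def)
  qed
  have "(\<Sum>n = 1..M. c n) = (\<Sum>r = 1..P. c r * real ((M + P - r) div P))"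
    using sum_by_residues[where c = c and Q = P and N = M and G = "\<lambda>_. 1"] P per by simp
  also have "\<dots> = (\<Sum>r = 1..P. c r * (y / P + 1/2) - c r * (r / P) - c r * saw (y / P - r / P))"
    by (intro sum.cong refl) (simp only: count, simp add: algebra_simps)
  also have "\<dots> = (\<Sum>r = 1..P. c r) * (y / P + 1/2) - (\<Sum>r = 1..P. c r * (r / P)) - (\<Sum>r = 1..P. c r * saw (y / P - r / P))"
    by (simp only: sum_subtractf sum_distrib_right)
  finally show ?thesis unfolding M_def zero by simp
qed

lemma abs_first_moment_le: 
  assumes "P > 0"
  shows "\<bar>\<Sum>r = 1..P. c r * (real r / P)\<bar> \<le> period_norm P c"
  unfolding period_norm_def
proof (intro order_trans[OF sum_abs] sum_mono)
  fix r assume "r \<in> {1..P}"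
  then have "\<bar>real r / real P\<bar> \<le> 1" by simp
  then show "\<bar>c r * (real r / P)\<bar> \<le> \<bar>c r\<bar>"
    unfolding abs_mult using mult_left_mono[of "\<bar>real r / real P\<bar>" 1 "\<bar>c r\<bar>"] by simp
qed

lemma abs_partial_sum_le:
  assumes c: "periodic_mean_zero P c"
  shows "\<bar>\<Sum>n = 1..M. c n\<bar> \<le> 2 * period_norm P c"
proof -
  have "\<bar>\<Sum>r = 1..P. c r * saw (real M / P - r / P)\<bar> \<le> period_norm P c"
    unfolding period_norm_def
  proof (intro order_trans[OF sum_abs] sum_mono)
    fix r show "\<bar>c r * saw (real M / P - real r / P)\<bar> \<le> \<bar>c r\<bar>"
      unfolding abs_mult using mult_left_mono[OF abs_saw_le, of "\<bar>c r\<bar>"] by simp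
  qed
  moreover have "\<bar>\<Sum>r = 1..P. c r * (real r / P)\<bar> \<le> period_norm P c"
    using c by (intro abs_first_moment_le) (simp add: periodic_mean_zero_def)
  moreover have "(\<Sum>n = 1..M. c n) = - (\<Sum>r = 1..P. c r * (r / P)) - (\<Sum>r = 1..P. c r * saw (real M / P - r / P))"
    using partial_sum_eq_saw[OF c, of "real M"] by simp
  ultimately show ?thesis by linarith
qed

text \<open>In the class \<open>m = s + Q k\<close> the argument \<open>(N / m) / P\<close> of the sawtooth is \<open>A / (k + s / Q)\<close> with
  \<open>A = N / (P Q)\<close>. Thus the sum reduces to \<open>saw_hyperbola_sum\<close> for \<open>X = A powr (1/3)\<close>, where the bound
  \<open>R^2 \<le> N\<close> turns into the condition with \<open>\<kappa> = P Q\<close>.\<close>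

lemma abs_half_sum_le:
  fixes N R P Q :: nat
  assumes c: "periodic_mean_zero P c" and d: "periodic_mean_zero Q d"
    and N: "P * Q \<le> N" and R: "R\<^sup>2 \<le> N"
  shows "\<bar>\<Sum>m = 1..R. d m * (\<Sum>n = 1..N div m. c n)\<bar>
    \<le> period_norm P c * period_norm Q d * (293064 + 4740388 * (real P * real Q))
        * (real N powr (1/3) * (1 + ln N)\<^sup>2)"
proof -
  define V where "V = real N powr (1/3) * (1 + ln (real N))\<^sup>2"
  define W where "W = (293062 + 4740388 * (real P * real Q)) * V"
  have P: "P > 0" and Q: "Q > 0" and per: "\<And>n. d (n + Q) = d n"
    using c d by (auto simp: periodic_mean_zero_def)
  have PQ1: "real P * real Q \<ge> 1"
    using P Q by (metis One_nat_def Suc_leI mult_pos_pos of_nat_1 of_nat_le_iff of_nat_mult)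
  have PQN: "real P * real Q \<le> N" using N by (metis of_nat_le_iff of_nat_mult)
  have N1: "real N \<ge> 1" using PQ1 PQN by linarith
  define X where "X = (N / (real P * real Q)) powr (1/3)"
  have X3: "X ^ 3 = N / (real P * real Q)"
    unfolding X_def using P Q N1 by (subst powr_power) auto
  have X1: "X \<ge> 1" unfolding X_def using PQ1 PQN by (intro ge_one_powr_ge_zero) auto
  have XN: "X \<le> real N powr (1/3)"
    unfolding X_def using PQ1 N1 by (intro powr_mono2) (auto simp: divide_le_eq mult_le_cancel_left1)
  have V1: "V \<ge> 1"
    unfolding V_def using N1 mult_mono[of 1 "real N powr (1/3)" 1 "(1 + ln (real N))\<^sup>2"]
    by (simp add: ge_one_powr_ge_zero)
  have inner: "\<bar>\<Sum>k < (R + Q - s) div Q. saw ((N / real (s + Q * k)) / P - r / P)\<bar> \<le> W"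
    if s: "s \<in> {1..Q}" for s r
  proof -
    define K where "K = (R + Q - s) div Q"
    have "R + Q - s < (R + 1) * Q"
    proof -
      have "R * 1 \<le> R * Q" using Q by (intro mult_le_mono) auto
      moreover have "1 \<le> s" using s by simp
      ultimately show ?thesis using Q unfolding add_mult_distrib by linarith
    qed
    then have KR: "K \<le> R" unfolding K_def by (simp add: less_mult_imp_div_less flip: less_Suc_eq_le)
    have "K\<^sup>2 \<le> R\<^sup>2" using KR by (rule power_mono) simp
    then have K2: "K\<^sup>2 \<le> N" using R by linarith
    have "K \<le> K\<^sup>2" by (simp add: power2_eq_square)
    then have KN: "K \<le> N" using K2 by linarith
    have "\<bar>\<Sum>k<K. saw (X ^ 3 / (real k + s / Q) - r / P)\<bar>
        \<le> (293062 + 4740388 * (real P * real Q)) * X * (1 + ln (real N))\<^sup>2"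
    proof (rule saw_hyperbola_sum)
      have "real (K\<^sup>2) \<le> real N" using K2 by (simp only: of_nat_le_iff)
      then show "(real K)\<^sup>2 \<le> real P * real Q * X ^ 3" using P Q by (simp add: X3)
    qed (use X1 s KN N1 Q in auto)
    also have "\<dots> \<le> W"
      unfolding W_def V_def mult.assoc using XN PQ1 by (intro mult_left_mono mult_right_mono) auto
    also have "(\<Sum>k<K. saw (X ^ 3 / (real k + s / Q) - r / P)) = (\<Sum>k<K. saw ((N / real (s + Q * k)) / P - r / P))"
    proof (intro sum.cong refl)
      fix k
      have "real k + s / Q = real (s + Q * k) / Q" using Q by (simp add: field_simps)
      then have "X ^ 3 / (real k + s / Q) = (N / real (s + Q * k)) / P"
        using Q P s by (simp add: X3)
      then show "saw (X ^ 3 / (real k + s / Q) - r / P) = saw ((N / real (s + Q * k)) / P - r / P)"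
        by simp
    qed
    finally show ?thesis unfolding K_def .
  qed
  define K0 where "K0 = (\<Sum>r = 1..P. c r * (real r / P))"
  define S where "S r = (\<Sum>m = 1..R. d m * saw ((N / real m) / P - real r / P))" for r :: nat
  have S: "\<bar>S r\<bar> \<le> period_norm Q d * W" for r
  proof -
    have "S r = (\<Sum>s = 1..Q. d s * (\<Sum>k < (R + Q - s) div Q. saw ((N / real (s + Q * k)) / P - r / P)))"
      unfolding S_def by (rule sum_by_residues[where c = d and Q = Q]) (use Q per in auto)
    also have "\<bar>\<dots>\<bar> \<le> (\<Sum>s = 1..Q. \<bar>d s\<bar> * W)"
    proof (intro order_trans[OF sum_abs] sum_mono)
      fix s assume "s \<in> {1..Q}"
      then show "\<bar>d s * (\<Sum>k < (R + Q - s) div Q. saw ((N / real (s + Q * k)) / P - r / P))\<bar> \<le> \<bar>d s\<bar> * W"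
        unfolding abs_mult using inner by (intro mult_left_mono) auto
    qed
    finally show ?thesis by (simp add: period_norm_def sum_distrib_right)
  qed
  have "(\<Sum>n = 1..N div m. c n) = - K0 - (\<Sum>r = 1..P. c r * saw ((N / real m) / P - r / P))" for m
    using partial_sum_eq_saw[OF c, of "N / m"] by (simp add: K0_def floor_divide_of_nat_eq)
  then have "(\<Sum>m = 1..R. d m * (\<Sum>n = 1..N div m. c n))
      = (\<Sum>m = 1..R. d m * (- K0) - (\<Sum>r = 1..P. c r * (d m * saw ((N / real m) / P - r / P))))"
    by (intro sum.cong refl) (simp add: right_diff_distrib sum_distrib_left mult.left_commute)
  also have "\<dots> = - K0 * (\<Sum>m = 1..R. d m) - (\<Sum>m = 1..R. \<Sum>r = 1..P. c r * (d m * saw ((N / real m) / P - r / P)))"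
    by (simp only: sum_subtractf sum_distrib_left mult.commute)
  also have "(\<Sum>m = 1..R. \<Sum>r = 1..P. c r * (d m * saw ((N / real m) / P - r / P))) = (\<Sum>r = 1..P. c r * S r)"
    unfolding S_def sum_distrib_left by (rule sum.swap)
  finally have eq: "(\<Sum>m = 1..R. d m * (\<Sum>n = 1..N div m. c n)) = - K0 * (\<Sum>m = 1..R. d m) - (\<Sum>r = 1..P. c r * S r)" .
  have A: "\<bar>K0 * (\<Sum>m = 1..R. d m)\<bar> \<le> period_norm P c * (2 * period_norm Q d)"
    unfolding abs_mult K0_def using abs_first_moment_le[OF P] abs_partial_sum_le[OF d]
    by (intro mult_mono) (auto simp: period_norm_nonneg)
  have "\<bar>\<Sum>r = 1..P. c r * S r\<bar> \<le> (\<Sum>r = 1..P. \<bar>c r\<bar> * (period_norm Q d * W))"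
    using S by (intro order_trans[OF sum_abs] sum_mono) (auto simp: abs_mult intro: mult_left_mono)
  also have "\<dots> = period_norm P c * (period_norm Q d * W)"
    by (simp add: period_norm_def sum_distrib_right)
  finally have B: "\<bar>\<Sum>r = 1..P. c r * S r\<bar> \<le> period_norm P c * (period_norm Q d * W)" .
  have "period_norm P c * (2 * period_norm Q d) \<le> period_norm P c * (2 * period_norm Q d) * V"
    using mult_left_mono[OF V1, of "period_norm P c * (2 * period_norm Q d)"]
    by (simp add: period_norm_nonneg)
  then have "\<bar>\<Sum>m = 1..R. d m * (\<Sum>n = 1..N div m. c n)\<bar>
      \<le> period_norm P c * (2 * period_norm Q d) * V + period_norm P c * (period_norm Q d * W)"
    using A B eq by linarith
  also have "\<dots> = period_norm P c * period_norm Q d * (293064 + 4740388 * (real P * real Q)) * V"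
    by (simp add: W_def algebra_simps)
  finally show ?thesis unfolding V_def .
qed

section \<open>The divisor sum twisted by periodic functions\<close>

lemma finite_hyperbola_nat: "finite {(n :: nat, m :: nat). 1 \<le> n \<and> 1 \<le> m \<and> n * m \<le> N}"
  using finite_hyperbola[of "real N"] by (simp only: of_nat_le_iff)

text \<open>Pairs with both factors at most \<open>R\<close> are counted twice, once for each order of summation.\<close>

lemma hyperbola_method:
  fixes c d :: "nat \<Rightarrow> real" and N R :: nat
  assumes R: "R\<^sup>2 \<le> N" "N < (R + 1)\<^sup>2"
  shows "(\<Sum>(n, m) \<in> {(n, m). 1 \<le> n \<and> 1 \<le> m \<and> n * m \<le> N}. c n * d m)
    = (\<Sum>m = 1..R. d m * (\<Sum>n = 1..N div m. c n)) + (\<Sum>n = 1..R. c n * (\<Sum>m = 1..N div n. d m))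
      - (\<Sum>n = 1..R. c n) * (\<Sum>m = 1..R. d m)"
proof -
  define f where "f = (\<lambda>(n, m). c n * d m)"
  define A where "A = {(n, m). 1 \<le> n \<and> m \<in> {1..R} \<and> n * m \<le> N}"
  define B where "B = {(n, m). n \<in> {1..R} \<and> 1 \<le> m \<and> n * m \<le> N}"
  have fin: "finite A" "finite B"
    by (auto simp: A_def B_def intro!: finite_subset[OF _ finite_hyperbola_nat[of N]])
  have union: "{(n, m). 1 \<le> n \<and> 1 \<le> m \<and> n * m \<le> N} = A \<union> B"
  proof -
    \<comment> \<open>Two factors above \<open>R\<close> have a product of at least \<open>(R + 1)\<^sup>2 > N\<close>.\<close>
    have False if "n * m \<le> N" "R < n" "R < m" for n m
    proof -
      have "(R + 1) * (R + 1) \<le> n * m" using that by (intro mult_le_mono) auto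
      then show False using that R by (simp add: power2_eq_square)
    qed
    then show ?thesis by (force simp: A_def B_def)
  qed
  have inter: "A \<inter> B = {1..R} \<times> {1..R}"
  proof -
    have "n * m \<le> N" if "n \<le> R" "m \<le> R" for n m
      using mult_le_mono[OF that] R(1) by (simp add: power2_eq_square)
    then show ?thesis by (auto simp: A_def B_def)
  qed
  have "sum f A = (\<Sum>(m, n) \<in> Sigma {1..R} (\<lambda>m. {1..N div m}). c n * d m)"
    by (rule sum.reindex_bij_witness[where i = prod.swap and j = prod.swap])
      (auto simp: A_def f_def less_eq_div_iff_mult_less_eq)
  then have A: "sum f A = (\<Sum>m = 1..R. d m * (\<Sum>n = 1..N div m. c n))"
    by (simp add: sum.Sigma sum_distrib_left mult.commute)
  have "B = Sigma {1..R} (\<lambda>n. {1..N div n})"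
    by (auto simp: B_def less_eq_div_iff_mult_less_eq mult.commute)
  then have B: "sum f B = (\<Sum>n = 1..R. c n * (\<Sum>m = 1..N div n. d m))"
    by (simp add: f_def sum.Sigma sum_distrib_left)
  have I: "sum f (A \<inter> B) = (\<Sum>n = 1..R. c n) * (\<Sum>m = 1..R. d m)"
    unfolding inter f_def by (simp add: sum_product sum.cartesian_product)
  show ?thesis
    using sum.union_inter[OF fin, of f] unfolding A B I union by (simp add: f_def)
qed

lemma abs_periodic_divisor_sum_le:
  assumes c: "periodic_mean_zero P c" and d: "periodic_mean_zero Q d" and N: "P * Q \<le> N"
  shows "\<bar>\<Sum>(n, m) \<in> {(n, m). 1 \<le> n \<and> 1 \<le> m \<and> n * m \<le> N}. c n * d m\<bar>
    \<le> period_norm P c * period_norm Q d * (586132 + 9480776 * (real P * real Q))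
        * (real N powr (1/3) * (1 + ln N)\<^sup>2)"
proof -
  define R where "R = nat \<lfloor>sqrt N\<rfloor>"
  define Y where "Y = period_norm P c * period_norm Q d"
  define V where "V = real N powr (1/3) * (1 + ln (real N))\<^sup>2"
  have "real R \<le> sqrt N" "sqrt N < real (R + 1)"
    unfolding R_def by (simp_all add: le_nat_floor) linarith+
  then have "(real R)\<^sup>2 \<le> (sqrt N)\<^sup>2" "(sqrt N)\<^sup>2 < (real (R + 1))\<^sup>2"
    by (intro power_mono power_strict_mono; simp)+
  moreover have "(sqrt N)\<^sup>2 = real N" by simp
  ultimately have "real (R\<^sup>2) \<le> real N" "real N < real ((R + 1)\<^sup>2)"
    by (simp_all only: of_nat_power)
  then have R: "R\<^sup>2 \<le> N" "N < (R + 1)\<^sup>2"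
    by (simp_all only: of_nat_le_iff of_nat_less_iff)
  have "1 \<le> P * Q" using c d by (simp add: periodic_mean_zero_def Suc_le_eq)
  then have "1 \<le> N" using N by (rule order_trans)
  then have N1: "real N \<ge> 1" by simp
  have V1: "V \<ge> 1"
    unfolding V_def using N1 mult_mono[of 1 "real N powr (1/3)" 1 "(1 + ln (real N))\<^sup>2"]
    by (simp add: ge_one_powr_ge_zero)
  have Y0: "Y \<ge> 0" by (simp add: Y_def period_norm_nonneg)
  have S1: "\<bar>\<Sum>m = 1..R. d m * (\<Sum>n = 1..N div m. c n)\<bar> \<le> Y * (293064 + 4740388 * (real P * real Q)) * V"
    unfolding V_def Y_def using abs_half_sum_le[OF c d N R(1)] .
  have S2: "\<bar>\<Sum>n = 1..R. c n * (\<Sum>m = 1..N div n. d m)\<bar> \<le> Y * (293064 + 4740388 * (real P * real Q)) * V"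
    unfolding V_def Y_def using abs_half_sum_le[OF d c _ R(1)] N by (simp add: mult.commute mult.left_commute)
  have "\<bar>(\<Sum>n = 1..R. c n) * (\<Sum>m = 1..R. d m)\<bar> \<le> (2 * period_norm P c) * (2 * period_norm Q d)"
    unfolding abs_mult using abs_partial_sum_le[OF c] abs_partial_sum_le[OF d]
    by (intro mult_mono) (auto simp: period_norm_nonneg)
  also have "\<dots> = 4 * Y" by (simp add: Y_def)
  also have "\<dots> \<le> 4 * Y * V" using mult_left_mono[OF V1, of "4 * Y"] Y0 by simp
  finally have S3: "\<bar>(\<Sum>n = 1..R. c n) * (\<Sum>m = 1..R. d m)\<bar> \<le> 4 * Y * V" .
  have "\<bar>\<Sum>(n, m) \<in> {(n, m). 1 \<le> n \<and> 1 \<le> m \<and> n * m \<le> N}. c n * d m\<bar>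
      \<le> Y * (293064 + 4740388 * (real P * real Q)) * V
        + Y * (293064 + 4740388 * (real P * real Q)) * V + 4 * Y * V"
    unfolding hyperbola_method[OF R] using S1 S2 S3 by linarith
  also have "\<dots> = Y * (586132 + 9480776 * (real P * real Q)) * V"
    by (simp add: algebra_simps)
  finally show ?thesis unfolding V_def Y_def .
qed

section \<open>The primed sum of cosines\<close>

text \<open>A term with \<open>n m = x\<close> occurs in the sum over \<open>n m \<le> x\<close> but not in the sum over \<open>n m < x\<close>, so the
  mean of the two gives it the weight \<open>1/2\<close>. The upper limit \<open>\<lceil>x\<rceil> - 1\<close> is the largest integer below \<open>x\<close>.\<close>

lemma hyperbola_sum'_eq_average:
  fixes f :: "nat \<Rightarrow> nat \<Rightarrow> real" and x :: real
  assumes x: "x \<ge> 1"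
  defines "S \<equiv> \<lambda>N::nat. (\<Sum>(n, m) \<in> {(n, m). 1 \<le> n \<and> 1 \<le> m \<and> n * m \<le> N}. f n m)"
  shows "hyperbola_sum' f x = (S (nat \<lfloor>x\<rfloor>) + S (nat (\<lceil>x\<rceil> - 1))) / 2"
proof -
  define D where "D = {(n :: nat, m :: nat). 1 \<le> n \<and> 1 \<le> m \<and> real (n * m) \<le> x}"
  have le: "real k \<le> x \<longleftrightarrow> k \<le> nat \<lfloor>x\<rfloor>" for k
    using x by (simp add: le_nat_iff le_floor_iff)
  have less: "real k < x \<longleftrightarrow> k \<le> nat (\<lceil>x\<rceil> - 1)" for k
    using x less_ceiling_iff[of "int k" x] by (auto simp: le_nat_iff)
  have fin: "finite D" unfolding D_def by (rule finite_hyperbola)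
  have S1: "S (nat \<lfloor>x\<rfloor>) = (\<Sum>(n, m)\<in>D. f n m)"
    unfolding S_def D_def le ..
  have "{(n, m). 1 \<le> n \<and> 1 \<le> m \<and> n * m \<le> nat (\<lceil>x\<rceil> - 1)} = {p \<in> D. real (fst p * snd p) < x}"
    unfolding D_def less[symmetric] by auto
  then have S2: "S (nat (\<lceil>x\<rceil> - 1)) = (\<Sum>(n, m)\<in>D. if real (n * m) < x then f n m else 0)"
    unfolding S_def by (simp add: sum.inter_filter[OF fin] case_prod_beta)
  have "hyperbola_sum' f x = (\<Sum>(n, m)\<in>D. (f n m + (if real (n * m) < x then f n m else 0)) / 2)"
    unfolding hyperbola_sum'_def D_def[symmetric]
    by (intro sum.cong refl) (auto simp: D_def simp del: of_nat_mult)
  also have "\<dots> = (S (nat \<lfloor>x\<rfloor>) + S (nat (\<lceil>x\<rceil> - 1))) / 2"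
    unfolding S1 S2 by (simp add: case_prod_beta sum.distrib flip: sum_divide_distrib)
  finally show ?thesis .
qed

text \<open>The sum over a period is the real part of a geometric sum whose ratio is a \<open>p\<close>-th root of unity, and
  this root differs from \<open>1\<close> because \<open>p\<close> does not divide \<open>a\<close>.\<close>

lemma periodic_mean_zero_cos:
  fixes p :: nat and a :: int
  assumes p: "p > 0" and a: "\<not> int p dvd a"
  shows "periodic_mean_zero p (\<lambda>n. cos (2 * pi * real n * real_of_int a / real p))"
proof -
  define \<theta> where "\<theta> = 2 * pi * real_of_int a / real p"
  have p\<theta>: "real p * \<theta> = 2 * pi * a" using p by (simp add: \<theta>_def)
  have \<theta>: "2 * pi * real n * real_of_int a / real p = real n * \<theta>" for n
    by (simp add: \<theta>_def)
  have shift: "cos (real (n + p) * \<theta>) = cos (real n * \<theta>)" for n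
  proof -
    have "real (n + p) * \<theta> = real n * \<theta> + 2 * pi * a" by (simp add: distrib_right p\<theta>)
    then show ?thesis by (simp add: cos_add sin_int_2pin cos_int_2pin)
  qed
  have "cis \<theta> \<noteq> 1"
  proof
    assume "cis \<theta> = 1"
    then have "cos \<theta> = 1" by (simp add: complex_eq_iff)
    then obtain k :: int where "\<theta> = of_int k * 2 * pi" using cos_one_2pi_int by blast
    then have "real_of_int a = real_of_int (k * int p)"
      using p by (simp add: \<theta>_def field_simps)
    then have "a = k * int p" by (simp only: of_int_eq_iff)
    then show False using a by simp
  qed
  moreover have "cis \<theta> ^ p = 1"
  proof -
    have "cis \<theta> ^ p = cis (2 * pi * a)" by (simp add: Complex.DeMoivre p\<theta>)
    also have "\<dots> = 1" by (rule cis_multiple_2pi) simp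
    finally show ?thesis .
  qed
  ultimately have "(\<Sum>n<p. cis \<theta> ^ n) = 0"
    by (simp add: sum_gp_strict)
  then have "Re (\<Sum>n<p. cis \<theta> ^ n) = 0" by simp
  then have "(\<Sum>n<p. cos (real n * \<theta>)) = 0"
    by (simp add: Complex.DeMoivre)
  moreover have "(\<Sum>n = 1..p. cos (real n * \<theta>)) = (\<Sum>n<p. cos (real (Suc n) * \<theta>))"
    using sum.shift_bounds_cl_Suc_ivl[of "\<lambda>n. cos (real n * \<theta>)" 0 "p - 1"] p
    by (cases p) (simp_all add: lessThan_Suc_atMost atMost_atLeast0)
  moreover have "(\<Sum>n<p. cos (real (Suc n) * \<theta>)) = (\<Sum>n<p. cos (real n * \<theta>))"
    using sum.lessThan_Suc_shift[of "\<lambda>n. cos (real n * \<theta>)" p] shift[of 0] by simp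
  ultimately show ?thesis
    unfolding periodic_mean_zero_def \<theta> using p shift by simp
qed

theorem theorem7p4:
  fixes p q :: nat and a b :: int and \<epsilon> :: real
  assumes "prime p" and "prime q"
    and "\<not> int p dvd a" and "\<not> int q dvd b"
    and "\<epsilon> > 0"
  shows "CC p q a b \<in> O[at_top](\<lambda>x. x powr (1/3 + \<epsilon>))"
proof -
  define c where "c n = cos (2 * pi * real n * real_of_int a / real p)" for n :: nat
  define d where "d n = cos (2 * pi * real n * real_of_int b / real q)" for n :: nat
  define S where "S N = (\<Sum>(n, m) \<in> {(n, m). 1 \<le> n \<and> 1 \<le> m \<and> n * m \<le> N}. c n * d m)" for N :: nat
  define C where "C = period_norm p c * period_norm q d * (586132 + 9480776 * (real p * real q))"
  have c: "periodic_mean_zero p c"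
    unfolding c_def using assms by (intro periodic_mean_zero_cos) (auto simp: prime_gt_0_nat)
  have d: "periodic_mean_zero q d"
    unfolding d_def using assms by (intro periodic_mean_zero_cos) (auto simp: prime_gt_0_nat)
  have C0: "C \<ge> 0" by (simp add: C_def period_norm_nonneg)
  have S: "\<bar>S N\<bar> \<le> C * (x powr (1/3) * (1 + ln x)\<^sup>2)" if "p * q \<le> N" "real N \<le> x" "1 \<le> N" for N x
  proof -
    have "\<bar>S N\<bar> \<le> C * (real N powr (1/3) * (1 + ln N)\<^sup>2)"
      unfolding S_def C_def by (rule abs_periodic_divisor_sum_le[OF c d that(1)])
    also have "\<dots> \<le> C * (x powr (1/3) * (1 + ln x)\<^sup>2)"
      using that C0 by (intro mult_left_mono mult_mono powr_mono2 power_mono add_left_mono ln_mono) auto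
    finally show ?thesis .
  qed
  have bound: "\<bar>CC p q a b x\<bar> \<le> C * (x powr (1/3) * (1 + ln x)\<^sup>2)" if x: "x \<ge> real (p * q) + 2" for x
  proof -
    have "int (p * q) + 2 \<le> \<lfloor>x\<rfloor>" using x by (simp add: le_floor_iff)
    moreover have "\<lfloor>x\<rfloor> \<le> \<lceil>x\<rceil>" by linarith
    ultimately have ge: "p * q \<le> nat \<lfloor>x\<rfloor>" "1 \<le> nat \<lfloor>x\<rfloor>" "p * q \<le> nat (\<lceil>x\<rceil> - 1)" "1 \<le> nat (\<lceil>x\<rceil> - 1)"
      by linarith+
    have "0 \<le> real (p * q)" by (rule of_nat_0_le_iff)
    then have "x \<ge> 1" using x by linarith
    then have le: "real (nat \<lfloor>x\<rfloor>) \<le> x" "real (nat (\<lceil>x\<rceil> - 1)) \<le> x" by linarith+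
    have "CC p q a b x = (S (nat \<lfloor>x\<rfloor>) + S (nat (\<lceil>x\<rceil> - 1))) / 2"
      unfolding CC_def S_def c_def d_def by (rule hyperbola_sum'_eq_average[OF \<open>x \<ge> 1\<close>])
    moreover have "\<bar>(s + t) / 2\<bar> \<le> B" if "\<bar>s\<bar> \<le> B" "\<bar>t\<bar> \<le> B" for s t B :: real
      using that unfolding abs_le_iff by (auto simp: field_simps)
    ultimately show ?thesis using S[OF ge(1) le(1) ge(2)] S[OF ge(3) le(2) ge(4)] by metis
  qed
  have "CC p q a b \<in> O[at_top](\<lambda>x. x powr (1/3) * (1 + ln x)\<^sup>2)"
  proof (rule bigoI[where c = C])
    show "\<forall>\<^sub>F x in at_top. norm (CC p q a b x) \<le> C * norm (x powr (1/3) * (1 + ln x)\<^sup>2)"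
      using eventually_ge_at_top[of "real (p * q) + 2"]
      by eventually_elim (use bound in \<open>simp add: abs_mult\<close>)
  qed
  also have "(\<lambda>x. x powr (1/3) * (1 + ln x)\<^sup>2) \<in> O[at_top](\<lambda>x. x powr (1/3 + \<epsilon>))"
    using \<open>\<epsilon> > 0\<close> by real_asymp
  finally show ?thesis .
qed

end
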